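(* For every integer $k \geq 1$, \[ \frac{1}{2} \left( -\frac{1}{2k+6}+\frac{4}{2k+5}-\frac{5}{2k+4}+\frac{4}{2k+2} \right) < \left| \ln(2) - AHS_k \right| < \frac{1}{2} \left( \frac{1}{2k+4} - \frac{4}{2k+3} + \frac{5}{2k+2} \right), \] or equivalently \[ \frac{4k^3+32k^2+87k+83}{8k^4+68k^3+208k^2+268k+120} < \left| \ln(2) - AHS_k \right| < \frac{4k^2+16k+17}{8k^3+36k^2+52k+24}. \]
   Context: For an integer $k \geq 1$, $AHS_k$ denotes the $k$th partial sum of the alternating harmonic series, $AHS_k := \sum_{i=1}^{k} (-1)^{i+1} \frac{1}{i}$. *)

theory Defs
  imports Complex_Main
begin

definition AHS :: "nat \<Rightarrow> real" where
  "AHS k = (\<Sum>i = 1..k. (-1) ^ (i + 1) * (1 / real i))"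

end

theory Submission
  imports Defs "HOL-Analysis.Harmonic_Numbers" "HOL-Real_Asymp.Real_Asymp"
begin

text \<open>
  Write \<open>r k = (-1) ^ k * (ln 2 - AHS k)\<close>. Then \<open>r k - r (k + 2) = 1 / (k + 1) - 1 / (k + 2)\<close> and
  \<open>r k\<close> tends to \<open>0\<close>. Both bounds tend to \<open>0\<close> as well, and their two-step differences enclose
  this one; hence (upper bound) \<open>- r\<close> and \<open>r -\<close> (lower bound) strictly decrease along steps of
  two towards \<open>0\<close>, so they are positive.
\<close>

text \<open>A decreasing sequence stays above its limit, so the terms \<open>f (n + 2)\<close>,
  \<open>f (n + 4)\<close>, ... are nonnegative. Starting at \<open>n + 2\<close> leaves the strict
  step from \<open>n\<close> to make \<open>f n\<close> positive.\<close>

lemma two_step_decreasing_to_zero_pos: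
  fixes f :: "nat \<Rightarrow> real"
  assumes dec: "\<And>n. f (n + 2) < f n" and lim: "f \<longlonglongrightarrow> 0"
  shows "0 < f n"
proof -
  have "decseq (\<lambda>m. f (n + 2 + 2 * m))"
  proof (rule decseq_SucI)
    show "f (n + 2 + 2 * Suc m) \<le> f (n + 2 + 2 * m)" for m
      using dec[of "n + 2 + 2 * m"] by (simp add: algebra_simps)
  qed
  moreover have "(\<lambda>m. f (n + 2 + 2 * m)) \<longlonglongrightarrow> 0"
    by (rule filterlim_compose[OF lim]) real_asymp
  ultimately have "0 \<le> f (n + 2)"
    using decseq_ge[of "\<lambda>m. f (n + 2 + 2 * m)" 0 0] by simp
  with dec[of n] show ?thesis by linarith
qed

text \<open>The sign makes this the tail 1/(k+1) - 1/(k+2) + ..., which is positive for either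
  parity of \<open>k\<close>.\<close>

definition remainder :: "nat \<Rightarrow> real" where
  "remainder k = (-1) ^ k * (ln 2 - AHS k)"

definition upper :: "real \<Rightarrow> real" where
  "upper x = 1 / 2 * (1 / (2 * x + 4) - 4 / (2 * x + 3) + 5 / (2 * x + 2))"

text \<open>This is \<open>1 / (x + 1) - upper (x + 1)\<close>, mirroring the identity
  \<open>remainder k = 1 / (k + 1) - remainder (k + 1)\<close>.\<close>

definition lower :: "real \<Rightarrow> real" where
  "lower x = 1 / 2 * (- (1 / (2 * x + 6)) + 4 / (2 * x + 5) - 5 / (2 * x + 4) + 4 / (2 * x + 2))"

lemma AHS_Suc: "AHS (Suc k) = AHS k + (-1) ^ k / (real k + 1)"
  by (simp add: AHS_def add.commute)

lemma AHS_tendsto: "AHS \<longlonglongrightarrow> ln 2"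
proof -
  have "AHS = (\<lambda>k. \<Sum>i<k. (-1) ^ i / real (Suc i))"
  proof
    show "AHS k = (\<Sum>i<k. (-1) ^ i / real (Suc i))" for k
      by (induction k) (simp_all add: AHS_Suc add.commute, simp add: AHS_def)
  qed
  with alternating_harmonic_series_sums show ?thesis
    by (simp only: sums_def)
qed

lemma remainder_tendsto: "remainder \<longlonglongrightarrow> 0"
proof -
  have "(\<lambda>k. ln 2 - AHS k) \<longlonglongrightarrow> 0"
    using tendsto_diff[OF tendsto_const AHS_tendsto, of "ln 2"] by simp
  \<comment> \<open>Absolute values remove the oscillating factor \<open>(-1) ^ k\<close>.\<close>
  then have "(\<lambda>k. \<bar>remainder k\<bar>) \<longlonglongrightarrow> 0"
    by (simp add: remainder_def abs_mult tendsto_rabs_zero_iff)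
  then show ?thesis by (simp add: tendsto_rabs_zero_iff)
qed

lemma remainder_add_2:
  "remainder (k + 2) = remainder k - (1 / (real k + 1) - 1 / (real k + 2))"
proof -
  \<comment> \<open>The outer sign cancels against the signs of the two new summands.\<close>
  have "(-1) ^ k * ((-1) ^ k :: real) = 1"
    by (simp flip: power_mult_distrib)
  then show ?thesis
    by (simp add: remainder_def AHS_Suc algebra_simps add_divide_distrib)
qed

lemma upper_eq:
  assumes "0 \<le> x"
  shows "upper x = (4 * x ^ 2 + 16 * x + 17) / (8 * x ^ 3 + 36 * x ^ 2 + 52 * x + 24)"
proof -
  \<comment> \<open>Once factored, the denominator is visibly nonzero for \<open>0 \<le> x\<close>
    and can be cleared.\<close>
  have eq: "8 * x ^ 3 + 36 * x ^ 2 + 52 * x + 24 = (2 * x + 4) * (2 * x + 3) * (2 * x + 2)"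
    by algebra
  show ?thesis
    unfolding eq upper_def using assms by (simp add: divide_simps) algebra
qed

lemma lower_eq:
  assumes "0 \<le> x"
  shows "lower x = (4 * x ^ 3 + 32 * x ^ 2 + 87 * x + 83)
    / (8 * x ^ 4 + 68 * x ^ 3 + 208 * x ^ 2 + 268 * x + 120)"
proof -
  \<comment> \<open>The quartic is half the product of the four denominators in
    \<open>lower\<close>.\<close>
  have eq: "8 * x ^ 4 + 68 * x ^ 3 + 208 * x ^ 2 + 268 * x + 120
      = (2 * x + 6) * (2 * x + 5) * (2 * x + 4) * (2 * x + 2) / 2"
    by algebra
  show ?thesis
    unfolding eq lower_def using assms by (simp add: divide_simps) algebra
qed

text \<open>Over a common denominator the numerator of the gap collapses to the constant 120, and
  all factors below are positive.\<close>

lemma upper_diff: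
  assumes "0 \<le> x"
  shows "1 / (x + 1) - 1 / (x + 2) < upper x - upper (x + 2)"
proof -
  have "upper x - upper (x + 2) - (1 / (x + 1) - 1 / (x + 2)) = 120 / ((2*x+2) * (2*x+3) * (2*x+4) * (2*x+6) * (2*x+7) * (2*x+8))"
    using assms by (simp add: upper_def divide_simps) algebra
  moreover have "0 < 120 / ((2*x+2) * (2*x+3) * (2*x+4) * (2*x+6) * (2*x+7) * (2*x+8))" using assms by (simp add: divide_simps add_nonneg_pos)
  ultimately show ?thesis by linarith
qed

text \<open>Since \<open>lower x = 1 / (x + 1) - upper (x + 1)\<close>, the gap is the one for
  \<open>upper\<close> with \<open>x + 1\<close> in place of \<open>x\<close>.\<close>

lemma lower_diff:
  assumes "0 \<le> x"
  shows "lower x - lower (x + 2) < 1 / (x + 1) - 1 / (x + 2)"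
proof -
  have "1 / (x + 1) - 1 / (x + 2) - (lower x - lower (x + 2)) = 120 / ((2*x+4) * (2*x+5) * (2*x+6) * (2*x+8) * (2*x+9) * (2*x+10))"
    using assms by (simp add: lower_def divide_simps) algebra
  moreover have "0 < 120 / ((2*x+4) * (2*x+5) * (2*x+6) * (2*x+8) * (2*x+9) * (2*x+10))" using assms by (simp add: divide_simps add_nonneg_pos)
  ultimately show ?thesis by linarith
qed

lemma remainder_less_upper: "remainder k < upper (real k)"
proof -
  have "(\<lambda>k. upper (real k)) \<longlonglongrightarrow> 0"
    unfolding upper_def by real_asymp
  then have "(\<lambda>k. upper (real k) - remainder k) \<longlonglongrightarrow> 0"
    using tendsto_diff[OF _ remainder_tendsto] by fastforce
  moreover have "upper (real (n + 2)) - remainder (n + 2) < upper (real n) - remainder n" for n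
    using upper_diff[of "real n"] remainder_add_2[of n] by (simp add: add.commute)
  ultimately show ?thesis
    using two_step_decreasing_to_zero_pos[of "\<lambda>k. upper (real k) - remainder k" k] by simp
qed

lemma lower_less_remainder: "lower (real k) < remainder k"
proof -
  have "(\<lambda>k. lower (real k)) \<longlonglongrightarrow> 0"
    unfolding lower_def by real_asymp
  then have "(\<lambda>k. remainder k - lower (real k)) \<longlonglongrightarrow> 0"
    using tendsto_diff[OF remainder_tendsto] by fastforce
  moreover have "remainder (n + 2) - lower (real (n + 2)) < remainder n - lower (real n)" for n
    using lower_diff[of "real n"] remainder_add_2[of n] by (simp add: add.commute)
  ultimately show ?thesis
    using two_step_decreasing_to_zero_pos[of "\<lambda>k. remainder k - lower (real k)" k] by simp
qed

theorem proposition6: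
  fixes k :: nat
  assumes "k \<ge> 1"
  shows "(1 / 2 * (- (1 / (2 * real k + 6)) + 4 / (2 * real k + 5) - 5 / (2 * real k + 4) + 4 / (2 * real k + 2))
            < \<bar>ln 2 - AHS k\<bar>
          \<and> \<bar>ln 2 - AHS k\<bar>
            < 1 / 2 * (1 / (2 * real k + 4) - 4 / (2 * real k + 3) + 5 / (2 * real k + 2)))
       \<and> ((4 * real k ^ 3 + 32 * real k ^ 2 + 87 * real k + 83)
              / (8 * real k ^ 4 + 68 * real k ^ 3 + 208 * real k ^ 2 + 268 * real k + 120)
            < \<bar>ln 2 - AHS k\<bar>
          \<and> \<bar>ln 2 - AHS k\<bar>
            < (4 * real k ^ 2 + 16 * real k + 17)
              / (8 * real k ^ 3 + 36 * real k ^ 2 + 52 * real k + 24))"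
proof -
  \<comment> \<open>The single fraction has only positive coefficients, whereas the partial
    fractions have mixed signs.\<close>
  have "0 \<le> lower (real k)"
    by (simp add: lower_eq)
  with lower_less_remainder[of k] have "0 < remainder k" by linarith
  moreover have "\<bar>ln 2 - AHS k\<bar> = \<bar>remainder k\<bar>"
    by (simp add: remainder_def abs_mult)
  ultimately have "\<bar>ln 2 - AHS k\<bar> = remainder k" by simp
  then have "lower (real k) < \<bar>ln 2 - AHS k\<bar> \<and> \<bar>ln 2 - AHS k\<bar> < upper (real k)"
    using lower_less_remainder[of k] remainder_less_upper[of k] by simp
  then show ?thesis
    using lower_eq[of "real k"] upper_eq[of "real k"]
    by (simp only: lower_def upper_def of_nat_0_le_iff)
qed

end
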